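(* Let $d=2,3,\ldots$ and let $\lambda=(\lambda_1,\ldots,\lambda_d)$ with $\lambda_i>0$ for $1\le i\le d$; write $|\lambda|=\lambda_1+\cdots+\lambda_d$. For $x=(x_1,\ldots,x_d)\in\mathbb{R}^d$ and $r\ge 0$ such that $r|x_i|\le 1$ for $1\le i\le d$, $$\prod_{i=1}^d \frac{1}{(1-r x_i)^{\lambda_i}} = \frac{\Gamma(|\lambda|)}{\prod_{i=1}^d\Gamma(\lambda_i)}\int_{\mathcal{T}^d}\frac{1}{(1-r\langle x,u\rangle)^{|\lambda|}}\prod_{i=1}^d u_i^{\lambda_i-1}\,du .$$
   Context: $\mathcal{T}^d=\{u\in\mathbb{R}^d: u_i\ge 0 \text{ for all } i,\ u_1+\cdots+u_d=1\}$ is the simplex in homogeneous coordinates. The integral $\int_{\mathcal{T}^d} g(u)\,du$ means $\int_{T^{d-1}} g(u_1,\ldots,u_{d-1},1-u_1-\cdots-u_{d-1})\,du_1\cdots du_{d-1}$ with Lebesgue measure, where $T^{d-1}=\{(u_1,\ldots,u_{d-1}): u_i\ge 0,\ u_1+\cdots+u_{d-1}\le 1\}$. $\langle x,u\rangle=\sum_{i=1}^d x_iu_i$ is the Euclidean inner product. *)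

theory Defs
  imports "HOL-Analysis.Analysis"
begin

text \<open>
  Vectors in \<open>\<real>\<^sup>d\<close> are functions on the index set \<open>{1..d}\<close>. Sets of such vectors consist of
  functions that are extensional on their index set, as in the product measure \<open>PiM\<close>.
\<close>

definition hom_simplex :: "nat \<Rightarrow> (nat \<Rightarrow> real) set" where
  "hom_simplex d = {u \<in> {1..d} \<rightarrow>\<^sub>E UNIV. (\<forall>i\<in>{1..d}. 0 \<le> u i) \<and> (\<Sum>i=1..d. u i) = 1}"

text \<open>The simplex \<open>T\<^sup>d\<^sup>-\<^sup>1\<close>, with coordinates \<open>1, \<dots>, d - 1\<close>.\<close>

definition corner_simplex :: "nat \<Rightarrow> (nat \<Rightarrow> real) set" where
  "corner_simplex d =
     {v \<in> {1..<d} \<rightarrow>\<^sub>E UNIV. (\<forall>i\<in>{1..<d}. 0 \<le> v i) \<and> (\<Sum>i\<in>{1..<d}. v i) \<le> 1}"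

definition simplex_lift :: "nat \<Rightarrow> (nat \<Rightarrow> real) \<Rightarrow> nat \<Rightarrow> real" where
  "simplex_lift d v = v(d := 1 - (\<Sum>i\<in>{1..<d}. v i))"

abbreviation lebesgue_coords :: "nat \<Rightarrow> (nat \<Rightarrow> real) measure" where
  "lebesgue_coords d \<equiv> PiM {1..<d} (\<lambda>_. lborel)"

text \<open>
  The integral over \<open>hom_simplex d\<close> is by definition the integral over \<open>corner_simplex d\<close> of the
  function expressed in the first \<open>d - 1\<close> coordinates; \<open>bij_betw_simplex_lift\<close> below justifies this.
  The version for functions with values in \<open>[0, \<infinity>]\<close> allows divergent integrals.
\<close>

definition simplex_nn_integral :: "nat \<Rightarrow> ((nat \<Rightarrow> real) \<Rightarrow> ennreal) \<Rightarrow> ennreal" where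
  "simplex_nn_integral d g =
     (\<integral>\<^sup>+ v \<in> corner_simplex d. g (simplex_lift d v) \<partial>lebesgue_coords d)"

definition simplex_integrable :: "nat \<Rightarrow> ((nat \<Rightarrow> real) \<Rightarrow> real) \<Rightarrow> bool" where
  "simplex_integrable d g \<longleftrightarrow>
     set_integrable (lebesgue_coords d) (corner_simplex d) (\<lambda>v. g (simplex_lift d v))"

definition simplex_integral :: "nat \<Rightarrow> ((nat \<Rightarrow> real) \<Rightarrow> real) \<Rightarrow> real" where
  "simplex_integral d g =
     (LINT v : corner_simplex d | lebesgue_coords d. g (simplex_lift d v))"

lemma bij_betw_simplex_lift:
  assumes "d \<ge> 1"
  shows "bij_betw (simplex_lift d) (corner_simplex d) (hom_simplex d)"
proof -
  have ins: "{1..d} = insert d {1..<d}"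
    using assms by auto
  have split: "(\<Sum>i=1..d. u i) = u d + (\<Sum>i\<in>{1..<d}. u i)" for u :: "nat \<Rightarrow> real"
    unfolding ins by simp
  show ?thesis
  proof (rule bij_betw_byWitness[where f' = "\<lambda>u. restrict u {1..<d}"])
    show "\<forall>v\<in>corner_simplex d. restrict (simplex_lift d v) {1..<d} = v"
      by (auto simp: corner_simplex_def simplex_lift_def PiE_def extensional_def fun_eq_iff)
    show "\<forall>u\<in>hom_simplex d. simplex_lift d (restrict u {1..<d}) = u"
      by (auto simp: hom_simplex_def simplex_lift_def PiE_def extensional_def fun_eq_iff split[simplified])
    show "simplex_lift d ` corner_simplex d \<subseteq> hom_simplex d"
    proof clarify
      fix v assume v: "v \<in> corner_simplex d"
      have "(\<Sum>i\<in>{1..<d}. simplex_lift d v i) = (\<Sum>i\<in>{1..<d}. v i)"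
        by (intro sum.cong) (auto simp: simplex_lift_def)
      then have "(\<Sum>i=1..d. simplex_lift d v i) = 1"
        unfolding split by (simp add: simplex_lift_def)
      with v assms show "simplex_lift d v \<in> hom_simplex d"
        by (auto simp: corner_simplex_def hom_simplex_def simplex_lift_def PiE_def extensional_def)
    qed
    show "(\<lambda>u. restrict u {1..<d}) ` hom_simplex d \<subseteq> corner_simplex d"
    proof clarify
      fix u assume u: "u \<in> hom_simplex d"
      with assms have "u d \<ge> 0"
        by (simp add: hom_simplex_def)
      with u show "restrict u {1..<d} \<in> corner_simplex d"
        by (auto simp: corner_simplex_def hom_simplex_def split[simplified])
    qed
  qed
qed

end

theory Submission
  imports Defs
begin

text \<open>
  Put \<open>a i = 1 - r * x i \<ge> 0\<close>. Since the coordinates of a point \<open>u\<close> of the simplex sum to \<open>1\<close>,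
  \<open>1 - r * \<langle>x, u\<rangle> = \<langle>a, u\<rangle>\<close>, so the claim is homogeneous in \<open>a\<close>:
  \<open>\<Prod> a i powr - lam i\<close> is a Dirichlet average of \<open>\<langle>a, u\<rangle> powr - L\<close>, where \<open>L = \<Sum> lam i\<close>.

  Both sides are Gamma integrals (\<open>nn_integral_gamma_kernel\<close>). The left side, multiplied by
  \<open>\<Prod> Gamma (lam i)\<close>, is the integral of \<open>\<Prod> t i powr (lam i - 1) * exp (- a i * t i)\<close> over the
  positive orthant. Write \<open>t = s * u\<close> with \<open>s = \<Sum> t i\<close> and \<open>u\<close> in the simplex; the Jacobian is
  \<open>s ^ (d - 1)\<close> (\<open>nn_integral_PiM_sum_polar\<close>). Along the ray through \<open>u\<close> the integrand becomes
  \<open>s powr (L - 1) * exp (- \<langle>a, u\<rangle> * s) * \<Prod> u i powr (lam i - 1)\<close>, and the integral over \<open>s\<close> gives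
  \<open>Gamma L * \<langle>a, u\<rangle> powr - L\<close> times the Dirichlet weight (\<open>nn_integral_gamma_kernel_ray\<close>).

  All of this takes place in \<open>[0, \<infinity>]\<close>, where Tonelli's theorem applies without integrability
  conditions. A vanishing \<open>a i\<close> is therefore covered by the same computation, with both sides
  infinite. If all \<open>a i\<close> are positive, the left side is finite; this gives integrability, and the
  real identity follows.
\<close>

section \<open>The Gamma integral with a nonnegative rate\<close>

text \<open>
  The kernel vanishes outside the open half-line, so that integrals over the orthant and over the
  simplex become integrals over the whole space. With rate \<open>a = 0\<close> it is the truncated power
  \<open>t powr (l - 1)\<close>, one factor of the Dirichlet weight.
\<close>

definition gamma_kernel :: "real \<Rightarrow> real \<Rightarrow> real \<Rightarrow> real" where
  "gamma_kernel l a t = indicator {0<..} t * t powr (l - 1) * exp (- a * t)"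

lemma gamma_kernel_nonneg: "gamma_kernel l a t \<ge> 0"
  by (simp add: gamma_kernel_def)

lemma gamma_kernel_measurable [measurable]: "gamma_kernel l a \<in> borel_measurable borel"
  unfolding gamma_kernel_def [abs_def] by measurable

lemma gamma_kernel_scale:
  assumes "s > 0"
  shows "gamma_kernel l a (s * t) = s powr (l - 1) * gamma_kernel l (a * s) t"
  using assms by (auto simp: gamma_kernel_def indicator_def zero_less_mult_iff powr_mult mult_ac)

lemma nn_integral_gamma_kernel_1:
  assumes "l > 0"
  shows "(\<integral>\<^sup>+t. ennreal (gamma_kernel l 1 t) \<partial>lborel) = ennreal (Gamma l)"
  unfolding Gamma_conv_nn_integral_real[OF assms]
  by (intro nn_integral_cong) (auto simp: gamma_kernel_def indicator_def exp_minus field_simps)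

lemma nn_integral_gamma_kernel_scale:
  assumes "c > 0"
  shows "(\<integral>\<^sup>+t. ennreal (gamma_kernel l a t) \<partial>lborel) =
         ennreal (c powr l) * (\<integral>\<^sup>+t. ennreal (gamma_kernel l (a * c) t) \<partial>lborel)"
proof -
  have "(\<integral>\<^sup>+t. ennreal (gamma_kernel l a t) \<partial>lborel) =
        ennreal c * (\<integral>\<^sup>+t. ennreal (c powr (l - 1)) * ennreal (gamma_kernel l (a * c) t) \<partial>lborel)"
    using assms
    by (subst nn_integral_real_affine[where c = c and t = 0])
       (auto simp: gamma_kernel_scale gamma_kernel_nonneg ennreal_mult)
  also have "\<dots> = ennreal (c * c powr (l - 1)) * (\<integral>\<^sup>+t. ennreal (gamma_kernel l (a * c) t) \<partial>lborel)"
    using assms by (subst nn_integral_cmult) (auto simp: ennreal_mult mult.assoc)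
  also have "c * c powr (l - 1) = c powr l"
    using assms by (simp add: powr_mult_base)
  finally show ?thesis .
qed

text \<open>
  For \<open>a > 0\<close>, scaling by \<open>inverse a\<close> reduces the rate to \<open>1\<close>. For \<open>a = 0\<close> the quotient on the right
  is \<open>\<infinity>\<close>, and scaling shows that the integral is \<open>\<infinity>\<close> too: it is a positive \<open>J\<close> with
  \<open>J = 2 powr l * J\<close>.
\<close>

lemma nn_integral_gamma_kernel:
  assumes "l > 0" "a \<ge> 0"
  shows "(\<integral>\<^sup>+t. ennreal (gamma_kernel l a t) \<partial>lborel) = ennreal (Gamma l) / ennreal (a powr l)"
proof (cases "a = 0")
  case False
  with assms have a: "a > 0" by simp
  have "(\<integral>\<^sup>+t. ennreal (gamma_kernel l a t) \<partial>lborel) = ennreal (inverse a powr l) * ennreal (Gamma l)"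
    using a nn_integral_gamma_kernel_scale[of "inverse a" l a] nn_integral_gamma_kernel_1[OF assms(1)]
    by simp
  also have "\<dots> = ennreal (Gamma l) / ennreal (a powr l)"
    using a assms Gamma_real_pos[of l]
    by (simp add: divide_ennreal ennreal_mult[symmetric] powr_divide field_simps)
  finally show ?thesis .
next
  case True
  define J where "J = (\<integral>\<^sup>+t. ennreal (gamma_kernel l 0 t) \<partial>lborel)"
  have *: "J = ennreal (2 powr l) * J"
    unfolding J_def using nn_integral_gamma_kernel_scale[of 2 l 0] by simp
  have "ennreal (Gamma l) \<le> J"
    unfolding J_def nn_integral_gamma_kernel_1[OF assms(1), symmetric]
    by (intro nn_integral_mono ennreal_leI) (auto simp: gamma_kernel_def indicator_def mult_le_cancel_left1)
  hence pos: "J > 0"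
    using Gamma_real_pos[OF assms(1)] by (intro less_le_trans[of 0 "ennreal (Gamma l)" J]) simp_all
  have "J = \<infinity>"
  proof (rule ccontr)
    assume "J \<noteq> \<infinity>"
    then obtain j where j: "J = ennreal j" "j \<ge> 0"
      by (cases J) auto
    with pos have "j > 0" by simp
    from * j have "j = 2 powr l * j"
      by (metis ennreal_inj ennreal_mult mult_nonneg_nonneg powr_ge_zero)
    moreover have "2 powr l > 1" using assms by simp
    ultimately show False using \<open>j > 0\<close> by simp
  qed
  moreover have "Gamma l \<noteq> 0" "Gamma l \<ge> 0"
    using Gamma_real_pos[OF assms(1)] by simp_all
  ultimately show ?thesis
    using True unfolding J_def by (simp add: divide_ennreal_def ennreal_mult_top)
qed

section \<open>Polar coordinates with respect to the sum of the coordinates\<close>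

interpretation lborel_product: product_sigma_finite "\<lambda>_. lborel :: real measure" ..

lemma nn_integral_PiM_lborel_scale:
  fixes f :: "('i \<Rightarrow> real) \<Rightarrow> ennreal"
  assumes "finite I" "s \<noteq> 0" "f \<in> borel_measurable (PiM I (\<lambda>_. lborel))"
  shows "(\<integral>\<^sup>+x. f x \<partial>PiM I (\<lambda>_. lborel)) =
         ennreal (\<bar>s\<bar> ^ card I) * (\<integral>\<^sup>+x. f (\<lambda>i\<in>I. s * x i) \<partial>PiM I (\<lambda>_. lborel))"
  using assms(1,3)
proof (induction I arbitrary: f rule: finite_induct)
  case empty
  then show ?case
    by (subst (1 2) lborel_product.nn_integral_empty) (simp_all add: restrict_def)
next
  case (insert i I)
  note [measurable] = insert.prems
  interpret sigma_finite_measure "PiM I (\<lambda>_. lborel :: real measure)"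
    by (rule lborel_product.sigma_finite) fact
  have upd [measurable]: "(\<lambda>x. x(i := y)) \<in> PiM I (\<lambda>_. lborel) \<rightarrow>\<^sub>M PiM (insert i I) (\<lambda>_. lborel)"
    for y :: real
    by (rule measurable_fun_upd[where J = I]) auto
  have "(\<integral>\<^sup>+x. f x \<partial>PiM (insert i I) (\<lambda>_. lborel)) =
        (\<integral>\<^sup>+y. \<integral>\<^sup>+x. f (x(i := y)) \<partial>PiM I (\<lambda>_. lborel) \<partial>lborel)"
    using insert by (intro lborel_product.product_nn_integral_insert_rev) auto
  also have "\<dots> = ennreal \<bar>s\<bar> *
      (\<integral>\<^sup>+y. \<integral>\<^sup>+x. f (x(i := s * y)) \<partial>PiM I (\<lambda>_. lborel) \<partial>lborel)"
    using assms(2) by (subst nn_integral_real_affine[where c = s and t = 0]) simp_all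
  also have "(\<integral>\<^sup>+y. \<integral>\<^sup>+x. f (x(i := s * y)) \<partial>PiM I (\<lambda>_. lborel) \<partial>lborel) =
      (\<integral>\<^sup>+y. ennreal (\<bar>s\<bar> ^ card I) *
        (\<integral>\<^sup>+x. f ((\<lambda>k\<in>I. s * x k)(i := s * y)) \<partial>PiM I (\<lambda>_. lborel)) \<partial>lborel)"
    by (intro nn_integral_cong insert.IH) measurable
  also have "(\<lambda>y x. (\<lambda>k\<in>I. s * x k)(i := s * y)) = (\<lambda>y x. \<lambda>k\<in>insert i I. s * (x(i := y)) k)"
    using insert.hyps by (auto simp: fun_eq_iff)
  also have "(\<integral>\<^sup>+y. ennreal (\<bar>s\<bar> ^ card I) *
        (\<integral>\<^sup>+x. f (\<lambda>k\<in>insert i I. s * (x(i := y)) k) \<partial>PiM I (\<lambda>_. lborel)) \<partial>lborel) =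
      ennreal (\<bar>s\<bar> ^ card I) *
        (\<integral>\<^sup>+y. \<integral>\<^sup>+x. f (\<lambda>k\<in>insert i I. s * (x(i := y)) k) \<partial>PiM I (\<lambda>_. lborel) \<partial>lborel)"
    by (intro nn_integral_cmult) measurable
  also have "(\<integral>\<^sup>+y. \<integral>\<^sup>+x. f (\<lambda>k\<in>insert i I. s * (x(i := y)) k) \<partial>PiM I (\<lambda>_. lborel) \<partial>lborel) =
      (\<integral>\<^sup>+x. f (\<lambda>k\<in>insert i I. s * x k) \<partial>PiM (insert i I) (\<lambda>_. lborel))"
    using insert.hyps
    by (intro lborel_product.product_nn_integral_insert_rev[symmetric]) auto
  finally show ?case
    using insert.hyps by (simp add: ennreal_mult mult.assoc del: restrict_apply insert_iff)
qed

text \<open>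
  The map \<open>(v, s) \<mapsto> s * u\<close>, with \<open>u = v(j := 1 - \<Sum> v)\<close> the point of the hyperplane \<open>\<Sum> u = 1\<close> over
  \<open>v\<close>, is a composition of two elementary substitutions. First the coordinate \<open>t j\<close> is replaced by the
  sum \<open>s\<close> of all coordinates, a translation for fixed values of the others; then, for fixed
  \<open>s \<noteq> 0\<close>, the other coordinates are scaled by \<open>s\<close>, which contributes the factor \<open>\<bar>s\<bar> ^ card I\<close>.
\<close>

lemma nn_integral_PiM_sum_polar:
  fixes F :: "('i \<Rightarrow> real) \<Rightarrow> ennreal"
  assumes "finite I" "j \<notin> I"
    and [measurable]: "F \<in> borel_measurable (PiM (insert j I) (\<lambda>_. lborel))"
  shows "(\<integral>\<^sup>+t. F t \<partial>PiM (insert j I) (\<lambda>_. lborel)) =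
         (\<integral>\<^sup>+v. \<integral>\<^sup>+s. ennreal (\<bar>s\<bar> ^ card I) *
            F (\<lambda>i\<in>insert j I. s * (v(j := 1 - (\<Sum>k\<in>I. v k))) i)
          \<partial>lborel \<partial>PiM I (\<lambda>_. lborel))"
proof -
  interpret I: sigma_finite_measure "PiM I (\<lambda>_. lborel :: real measure)"
    by (rule lborel_product.sigma_finite) fact
  interpret P: pair_sigma_finite "PiM I (\<lambda>_. lborel :: real measure)" "lborel :: real measure" ..
  have upd [measurable]: "(\<lambda>v. v(j := g v)) \<in> PiM I (\<lambda>_. lborel) \<rightarrow>\<^sub>M PiM (insert j I) (\<lambda>_. lborel)"
    if "g \<in> borel_measurable (PiM I (\<lambda>_. lborel))" for g
    using that by (intro measurable_fun_upd[where J = I]) auto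
  have "(\<integral>\<^sup>+t. F t \<partial>PiM (insert j I) (\<lambda>_. lborel)) =
        (\<integral>\<^sup>+v. \<integral>\<^sup>+y. F (v(j := y)) \<partial>lborel \<partial>PiM I (\<lambda>_. lborel))"
    using assms by (intro lborel_product.product_nn_integral_insert) auto
  also have "\<dots> = (\<integral>\<^sup>+v. \<integral>\<^sup>+s. F (v(j := s - (\<Sum>k\<in>I. v k))) \<partial>lborel \<partial>PiM I (\<lambda>_. lborel))"
  proof (rule nn_integral_cong)
    fix v :: "'i \<Rightarrow> real" assume v: "v \<in> space (PiM I (\<lambda>_. lborel))"
    have [measurable]: "(\<lambda>y. F (v(j := y))) \<in> borel_measurable borel"
      using measurable_comp[OF measurable_component_update[OF v assms(2)] assms(3)]
      by (simp add: comp_def)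
    show "(\<integral>\<^sup>+y. F (v(j := y)) \<partial>lborel) = (\<integral>\<^sup>+s. F (v(j := s - (\<Sum>k\<in>I. v k))) \<partial>lborel)"
      by (subst nn_integral_real_affine[where c = 1 and t = "- (\<Sum>k\<in>I. v k)"]) auto
  qed
  also have "\<dots> = (\<integral>\<^sup>+s. \<integral>\<^sup>+v. F (v(j := s - (\<Sum>k\<in>I. v k))) \<partial>PiM I (\<lambda>_. lborel) \<partial>lborel)"
    by (rule P.Fubini'[symmetric]) measurable
  also have "\<dots> = (\<integral>\<^sup>+s. \<integral>\<^sup>+v. ennreal (\<bar>s\<bar> ^ card I) *
      F (\<lambda>i\<in>insert j I. s * (v(j := 1 - (\<Sum>k\<in>I. v k))) i) \<partial>PiM I (\<lambda>_. lborel) \<partial>lborel)"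
  proof (rule nn_integral_cong_AE)
    have eq: "(\<lambda>i\<in>I. s * v i)(j := s - (\<Sum>k\<in>I. (\<lambda>i\<in>I. s * v i) k)) =
        (\<lambda>i\<in>insert j I. s * (v(j := 1 - (\<Sum>k\<in>I. v k))) i)" for s and v :: "'i \<Rightarrow> real"
      using assms(2) by (auto simp: fun_eq_iff algebra_simps sum_distrib_left)
    show "AE s in lborel. (\<integral>\<^sup>+v. F (v(j := s - (\<Sum>k\<in>I. v k))) \<partial>PiM I (\<lambda>_. lborel)) =
        (\<integral>\<^sup>+v. ennreal (\<bar>s\<bar> ^ card I) *
          F (\<lambda>i\<in>insert j I. s * (v(j := 1 - (\<Sum>k\<in>I. v k))) i) \<partial>PiM I (\<lambda>_. lborel))"
      using AE_lborel_singleton[of 0]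
    proof eventually_elim
      case (elim s)
      have "(\<integral>\<^sup>+v. F (v(j := s - (\<Sum>k\<in>I. v k))) \<partial>PiM I (\<lambda>_. lborel)) =
          ennreal (\<bar>s\<bar> ^ card I) *
            (\<integral>\<^sup>+v. F ((\<lambda>i\<in>I. s * v i)(j := s - (\<Sum>k\<in>I. (\<lambda>i\<in>I. s * v i) k))) \<partial>PiM I (\<lambda>_. lborel))"
        using assms(1) elim by (intro nn_integral_PiM_lborel_scale) measurable
      also have "\<dots> = (\<integral>\<^sup>+v. ennreal (\<bar>s\<bar> ^ card I) *
          F (\<lambda>i\<in>insert j I. s * (v(j := 1 - (\<Sum>k\<in>I. v k))) i) \<partial>PiM I (\<lambda>_. lborel))"
        unfolding eq
      proof (rule nn_integral_cmult[symmetric])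
        have [measurable]: "(\<lambda>v. \<lambda>i\<in>insert j I. s * (v(j := 1 - (\<Sum>k\<in>I. v k))) i) \<in>
            PiM I (\<lambda>_. lborel) \<rightarrow>\<^sub>M PiM (insert j I) (\<lambda>_. lborel)"
        proof (rule measurable_restrict)
          fix i assume "i \<in> insert j I"
          then show "(\<lambda>v. s * (v(j := 1 - (\<Sum>k\<in>I. v k))) i) \<in> PiM I (\<lambda>_. lborel) \<rightarrow>\<^sub>M lborel"
            by (cases "i = j") auto
        qed
        show "(\<lambda>v. F (\<lambda>i\<in>insert j I. s * (v(j := 1 - (\<Sum>k\<in>I. v k))) i)) \<in>
            borel_measurable (PiM I (\<lambda>_. lborel))"
          by measurable
      qed
      finally show ?case .
    qed
  qed
  also have "\<dots> = (\<integral>\<^sup>+v. \<integral>\<^sup>+s. ennreal (\<bar>s\<bar> ^ card I) *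
      F (\<lambda>i\<in>insert j I. s * (v(j := 1 - (\<Sum>k\<in>I. v k))) i) \<partial>lborel \<partial>PiM I (\<lambda>_. lborel))"
    by (rule P.Fubini') measurable
  finally show ?thesis .
qed

section \<open>Dirichlet averages over the simplex\<close>

text \<open>
  On the ray through \<open>u\<close> the product of the kernels is a single Gamma kernel in \<open>s\<close>, of exponent
  \<open>\<Sum> lam i\<close> and rate \<open>\<Sum> a i * u i\<close>. For \<open>s \<le> 0\<close> the product vanishes because the numbers
  \<open>s * u i\<close> have the sum \<open>s\<close> and so cannot all be positive.
\<close>

lemma nn_integral_gamma_kernel_ray:
  fixes lam a u :: "'i \<Rightarrow> real"
  assumes J: "finite J" "J \<noteq> {}" "(\<Sum>i\<in>J. u i) = 1"
    and lam: "\<And>i. i \<in> J \<Longrightarrow> lam i > 0"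
    and a: "\<And>i. i \<in> J \<Longrightarrow> a i \<ge> 0"
  shows "(\<integral>\<^sup>+s. ennreal (\<bar>s\<bar> ^ (card J - 1)) *
            (\<Prod>i\<in>J. ennreal (gamma_kernel (lam i) (a i) (s * u i))) \<partial>lborel) =
         ennreal (Gamma (\<Sum>i\<in>J. lam i)) *
           (1 / ennreal ((\<Sum>i\<in>J. a i * u i) powr (\<Sum>i\<in>J. lam i)) *
            ennreal (\<Prod>i\<in>J. gamma_kernel (lam i) 0 (u i)))"
proof -
  define L where "L = (\<Sum>i\<in>J. lam i)"
  define A where "A = (\<Sum>i\<in>J. a i * u i)"
  have L: "L > 0"
    unfolding L_def using J lam by (intro sum_pos) auto
  have cJ: "card J > 0"
    using J by (simp add: card_gt_0_iff)
  have split: "\<bar>s\<bar> ^ (card J - 1) * (\<Prod>i\<in>J. gamma_kernel (lam i) (a i) (s * u i)) =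
      (\<Prod>i\<in>J. gamma_kernel (lam i) 0 (u i)) * gamma_kernel L A s" for s
  proof (cases "s > 0")
    case True
    have "gamma_kernel (lam i) (a i) (s * u i) =
        s powr (lam i - 1) * exp (- (a i * u i) * s) * gamma_kernel (lam i) 0 (u i)" for i
      using True by (simp add: gamma_kernel_scale) (simp add: gamma_kernel_def mult_ac)
    hence "(\<Prod>i\<in>J. gamma_kernel (lam i) (a i) (s * u i)) =
        (\<Prod>i\<in>J. s powr (lam i - 1)) * (\<Prod>i\<in>J. exp (- (a i * u i) * s)) *
          (\<Prod>i\<in>J. gamma_kernel (lam i) 0 (u i))"
      by (simp only: prod.distrib)
    also have "(\<Prod>i\<in>J. s powr (lam i - 1)) = s powr (L - card J)"
      using True J by (simp add: powr_sum[symmetric] L_def sum_subtractf)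
    also have "(\<Prod>i\<in>J. exp (- (a i * u i) * s)) = exp (- A * s)"
      using J by (simp add: exp_sum[symmetric] A_def sum_distrib_right sum_negf)
    finally have "\<bar>s\<bar> ^ (card J - 1) * (\<Prod>i\<in>J. gamma_kernel (lam i) (a i) (s * u i)) =
        (\<Prod>i\<in>J. gamma_kernel (lam i) 0 (u i)) *
          (s powr real (card J - 1) * s powr (L - card J) * exp (- A * s))"
      using True by (simp add: powr_realpow mult_ac)
    also have "s powr real (card J - 1) * s powr (L - card J) = s powr (L - 1)"
      using cJ by (simp add: powr_add[symmetric] of_nat_diff)
    finally show ?thesis
      using True by (simp add: gamma_kernel_def)
  next
    case False
    have "\<exists>i\<in>J. s * u i \<le> 0"
    proof (rule ccontr)
      assume "\<not> ?thesis"
      hence "(\<Sum>i\<in>J. s * u i) > 0"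
        using J by (intro sum_pos) auto
      with J False show False
        by (simp add: sum_distrib_left[symmetric])
    qed
    hence "(\<Prod>i\<in>J. gamma_kernel (lam i) (a i) (s * u i)) = 0"
      using J(1) by (force simp: gamma_kernel_def indicator_def)
    with False show ?thesis
      by (simp add: gamma_kernel_def)
  qed
  have "(\<integral>\<^sup>+s. ennreal (\<bar>s\<bar> ^ (card J - 1)) *
            (\<Prod>i\<in>J. ennreal (gamma_kernel (lam i) (a i) (s * u i))) \<partial>lborel) =
      (\<integral>\<^sup>+s. ennreal (\<Prod>i\<in>J. gamma_kernel (lam i) 0 (u i)) * ennreal (gamma_kernel L A s) \<partial>lborel)"
    by (intro nn_integral_cong)
       (simp add: prod_ennreal gamma_kernel_nonneg ennreal_mult[symmetric] prod_nonneg split[unfolded One_nat_def])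
  also have "\<dots> = ennreal (\<Prod>i\<in>J. gamma_kernel (lam i) 0 (u i)) *
      (\<integral>\<^sup>+s. ennreal (gamma_kernel L A s) \<partial>lborel)"
    by (rule nn_integral_cmult) measurable
  also have "\<dots> = ennreal (\<Prod>i\<in>J. gamma_kernel (lam i) 0 (u i)) *
      (ennreal (Gamma L) / ennreal (A powr L))"
  proof (cases "\<exists>i\<in>J. u i \<le> 0")
    \<comment> \<open>The rate \<open>A\<close> may be negative here, but the Dirichlet weight is zero.\<close>
    case True
    hence "(\<Prod>i\<in>J. gamma_kernel (lam i) 0 (u i)) = 0"
      using J(1) by (force simp: gamma_kernel_def indicator_def)
    thus ?thesis by simp
  next
    case False
    hence "A \<ge> 0"
      unfolding A_def using a by (intro sum_nonneg mult_nonneg_nonneg) force+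
    thus ?thesis
      using L by (simp add: nn_integral_gamma_kernel)
  qed
  finally show ?thesis
    by (simp add: L_def A_def divide_ennreal_def mult_ac)
qed

text \<open>
  The kernels of rate \<open>0\<close> confine the integral to the open simplex, so \<open>v\<close> can range over the whole
  coordinate space.
\<close>

theorem nn_integral_simplex_dirichlet:
  fixes lam a :: "'i \<Rightarrow> real"
  assumes I: "finite I" "j \<notin> I"
    and lam: "\<And>i. i \<in> insert j I \<Longrightarrow> lam i > 0"
    and a: "\<And>i. i \<in> insert j I \<Longrightarrow> a i \<ge> 0"
  defines "u \<equiv> \<lambda>v. v(j := 1 - (\<Sum>k\<in>I. v k))"
    and "L \<equiv> \<Sum>i\<in>insert j I. lam i"
  shows "(\<Prod>i\<in>insert j I. 1 / ennreal (a i powr lam i)) =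
         ennreal (Gamma L / (\<Prod>i\<in>insert j I. Gamma (lam i))) *
         (\<integral>\<^sup>+v. 1 / ennreal ((\<Sum>i\<in>insert j I. a i * u v i) powr L) *
               ennreal (\<Prod>i\<in>insert j I. gamma_kernel (lam i) 0 (u v i)) \<partial>PiM I (\<lambda>_. lborel))"
    (is "?lhs = _ * ?S")
proof -
  let ?J = "insert j I"
  define G where "G = (\<Prod>i\<in>?J. Gamma (lam i))"
  have G: "G > 0"
    unfolding G_def using lam by (intro prod_pos) (auto intro!: Gamma_real_pos)
  have L: "L > 0"
    unfolding L_def using I lam by (intro sum_pos) auto
  have u_meas [measurable]: "(\<lambda>v. u v i) \<in> borel_measurable (PiM I (\<lambda>_. lborel))" if "i \<in> ?J" for i
    using that unfolding u_def by (cases "i = j") (auto intro!: borel_measurable_diff borel_measurable_sum)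
  have su: "(\<Sum>i\<in>?J. u v i) = 1" for v
  proof -
    have "(\<Sum>i\<in>I. u v i) = (\<Sum>i\<in>I. v i)"
      using I by (intro sum.cong) (auto simp: u_def)
    thus ?thesis using I by (simp add: u_def)
  qed
  have "ennreal G * ?lhs = (\<Prod>i\<in>?J. ennreal (Gamma (lam i)) / ennreal (a i powr lam i))"
    using lam unfolding G_def
    by (subst prod_ennreal[symmetric])
       (auto simp: divide_ennreal_def prod.distrib[symmetric] intro!: less_imp_le Gamma_real_pos)
  also have "\<dots> = (\<Prod>i\<in>?J. \<integral>\<^sup>+t. ennreal (gamma_kernel (lam i) (a i) t) \<partial>lborel)"
    using lam a by (intro prod.cong) (auto simp: nn_integral_gamma_kernel)
  also have "\<dots> = (\<integral>\<^sup>+t. (\<Prod>i\<in>?J. ennreal (gamma_kernel (lam i) (a i) (t i))) \<partial>PiM ?J (\<lambda>_. lborel))"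
    using I by (intro lborel_product.product_nn_integral_prod[symmetric]) auto
  also have "\<dots> = (\<integral>\<^sup>+v. \<integral>\<^sup>+s. ennreal (\<bar>s\<bar> ^ card I) *
      (\<Prod>i\<in>?J. ennreal (gamma_kernel (lam i) (a i) ((\<lambda>i\<in>?J. s * u v i) i))) \<partial>lborel \<partial>PiM I (\<lambda>_. lborel))"
    unfolding u_def using I
    by (intro nn_integral_PiM_sum_polar) (auto intro!: borel_measurable_prod)
  also have "\<dots> = (\<integral>\<^sup>+v. \<integral>\<^sup>+s. ennreal (\<bar>s\<bar> ^ (card ?J - 1)) *
      (\<Prod>i\<in>?J. ennreal (gamma_kernel (lam i) (a i) (s * u v i))) \<partial>lborel \<partial>PiM I (\<lambda>_. lborel))"
    using I by (simp cong: prod.cong)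
  also have "\<dots> = (\<integral>\<^sup>+v. ennreal (Gamma L) * (1 / ennreal ((\<Sum>i\<in>?J. a i * u v i) powr L) *
      ennreal (\<Prod>i\<in>?J. gamma_kernel (lam i) 0 (u v i))) \<partial>PiM I (\<lambda>_. lborel))"
    unfolding L_def using I su lam a
    by (intro nn_integral_cong nn_integral_gamma_kernel_ray) auto
  also have "\<dots> = ennreal (Gamma L) * ?S"
    by (rule nn_integral_cmult) measurable
  finally have main: "ennreal G * ?lhs = ennreal (Gamma L) * ?S" .
  have "?lhs = ennreal (1 / G) * (ennreal G * ?lhs)"
    using G by (simp add: mult.assoc[symmetric] ennreal_mult[symmetric])
  also have "\<dots> = ennreal (Gamma L / G) * ?S"
    unfolding main mult.assoc[symmetric] using G L Gamma_real_pos[of L]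
    by (simp add: ennreal_mult[symmetric])
  finally show ?thesis
    by (simp add: G_def)
qed

text \<open>
  The closed and the open simplex carry the same weight pointwise, and not only almost everywhere,
  because \<open>0 powr b = 0\<close> for every \<open>b\<close>.
\<close>

lemma indicator_corner_simplex_lift:
  assumes "d \<ge> 1" "v \<in> space (lebesgue_coords d)"
  shows "indicator (corner_simplex d) v * (\<Prod>i=1..d. simplex_lift d v i powr (lam i - 1)) =
         (\<Prod>i=1..d. gamma_kernel (lam i) 0 (simplex_lift d v i))"
proof -
  have "v \<in> corner_simplex d \<longleftrightarrow> (\<forall>i\<in>{1..d}. simplex_lift d v i \<ge> 0)"
  proof -
    have "{1..d} = insert d {1..<d}" using assms by auto
    thus ?thesis
      using assms by (auto simp: corner_simplex_def simplex_lift_def space_PiM)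
  qed
  note corner = this
  show ?thesis
  proof (cases "\<forall>i\<in>{1..d}. simplex_lift d v i > 0")
    case True
    with corner have "v \<in> corner_simplex d" by (auto intro: less_imp_le)
    with True show ?thesis
      by (auto simp: gamma_kernel_def intro!: prod.cong)
  next
    case False
    then obtain i where i: "i \<in> {1..d}" "simplex_lift d v i \<le> 0"
      by (auto simp: not_less)
    hence "(\<Prod>i=1..d. gamma_kernel (lam i) 0 (simplex_lift d v i)) = 0"
      by (intro prod_zero bexI[of _ i]) (simp_all add: gamma_kernel_def)
    moreover have "v \<notin> corner_simplex d \<or>
        (\<Prod>i=1..d. simplex_lift d v i powr (lam i - 1)) = 0"
    proof (cases "simplex_lift d v i = 0")
      case True
      with i(1) have "(\<Prod>i=1..d. simplex_lift d v i powr (lam i - 1)) = 0"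
        by (intro prod_zero bexI[of _ i]) simp_all
      thus ?thesis ..
    next
      case False
      with i corner show ?thesis by force
    qed
    ultimately show ?thesis by (metis indicator_simps(2) mult_eq_0_iff)
  qed
qed

theorem theorem1p1:
  fixes d :: nat and lam x :: "nat \<Rightarrow> real" and r :: real
  assumes "d \<ge> 2"
    and "\<And>i. i \<in> {1..d} \<Longrightarrow> lam i > 0"
    and "r \<ge> 0"
    and "\<And>i. i \<in> {1..d} \<Longrightarrow> r * \<bar>x i\<bar> \<le> 1"
  shows
    "(\<Prod>i=1..d. 1 / ennreal ((1 - r * x i) powr lam i)) =
       ennreal (Gamma (\<Sum>i=1..d. lam i) / (\<Prod>i=1..d. Gamma (lam i))) *
       simplex_nn_integral d (\<lambda>u.
         1 / ennreal ((1 - r * (\<Sum>i=1..d. x i * u i)) powr (\<Sum>i=1..d. lam i)) *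
         ennreal (\<Prod>i=1..d. u i powr (lam i - 1)))
     \<and>
     ((\<forall>i\<in>{1..d}. r * x i \<noteq> 1) \<longrightarrow>
       simplex_integrable d (\<lambda>u.
         1 / (1 - r * (\<Sum>i=1..d. x i * u i)) powr (\<Sum>i=1..d. lam i) *
         (\<Prod>i=1..d. u i powr (lam i - 1))) \<and>
       (\<Prod>i=1..d. 1 / (1 - r * x i) powr lam i) =
         Gamma (\<Sum>i=1..d. lam i) / (\<Prod>i=1..d. Gamma (lam i)) *
         simplex_integral d (\<lambda>u.
           1 / (1 - r * (\<Sum>i=1..d. x i * u i)) powr (\<Sum>i=1..d. lam i) *
           (\<Prod>i=1..d. u i powr (lam i - 1))))"
proof -
  define L where "L = (\<Sum>i=1..d. lam i)"
  define G where "G = (\<Prod>i=1..d. Gamma (lam i))"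
  define a where "a i = 1 - r * x i" for i
  define u where "u = simplex_lift d"
  define A where "A v = 1 - r * (\<Sum>i=1..d. x i * u v i)" for v
  define w where "w v = (\<Prod>i=1..d. u v i powr (lam i - 1))" for v
  define C where "C = corner_simplex d"
  have ins: "insert d {1..<d} = {1..d}"
    using assms(1) by auto
  have a_nonneg: "a i \<ge> 0" if "i \<in> {1..d}" for i
  proof -
    have "r * x i \<le> r * \<bar>x i\<bar>"
      using assms(3) by (intro mult_left_mono) auto
    with assms(4)[OF that] show ?thesis by (simp add: a_def)
  qed
  have L: "L > 0"
    unfolding L_def using assms(1,2) by (intro sum_pos) auto
  have G: "G > 0"
    unfolding G_def using assms(2) by (intro prod_pos) (auto intro!: Gamma_real_pos)
  have u_meas [measurable]: "(\<lambda>v. u v i) \<in> borel_measurable (lebesgue_coords d)" if "i \<in> {1..d}" for i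
    using that unfolding u_def simplex_lift_def
    by (cases "i = d") (auto intro!: borel_measurable_diff borel_measurable_sum)
  have A: "(\<Sum>i=1..d. a i * u v i) = A v" for v
  proof -
    have "(\<Sum>i=1..d. u v i) = (\<Sum>i\<in>{1..<d}. v i) + u v d"
      unfolding ins[symmetric] by (auto simp: u_def simplex_lift_def intro!: sum.cong)
    hence "(\<Sum>i=1..d. u v i) = 1"
      by (simp add: u_def simplex_lift_def)
    thus ?thesis
      by (simp add: a_def A_def algebra_simps sum_subtractf sum_distrib_left)
  qed
  have wC: "indicator C v * w v = (\<Prod>i=1..d. gamma_kernel (lam i) 0 (u v i))"
    if "v \<in> space (lebesgue_coords d)" for v
    unfolding C_def w_def u_def using assms(1) that
    by (intro indicator_corner_simplex_lift) auto
  have "(\<Prod>i=1..d. 1 / ennreal (a i powr lam i)) = ennreal (Gamma L / G) *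
      (\<integral>\<^sup>+v. 1 / ennreal (A v powr L) *
        ennreal (\<Prod>i=1..d. gamma_kernel (lam i) 0 (u v i)) \<partial>lebesgue_coords d)"
    using nn_integral_simplex_dirichlet[of "{1..<d}" d lam a] assms(2) a_nonneg
    unfolding ins simplex_lift_def[symmetric] u_def[symmetric] A
    by (simp add: L_def G_def)
  also have "(\<integral>\<^sup>+v. 1 / ennreal (A v powr L) *
        ennreal (\<Prod>i=1..d. gamma_kernel (lam i) 0 (u v i)) \<partial>lebesgue_coords d) =
      (\<integral>\<^sup>+v\<in>C. (1 / ennreal (A v powr L) * ennreal (w v)) \<partial>lebesgue_coords d)"
  proof (rule nn_integral_cong)
    fix v assume v: "v \<in> space (lebesgue_coords d)"
    show "1 / ennreal (A v powr L) * ennreal (\<Prod>i=1..d. gamma_kernel (lam i) 0 (u v i)) =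
        1 / ennreal (A v powr L) * ennreal (w v) * indicator C v"
      unfolding wC[OF v, symmetric] by (simp add: indicator_def)
  qed
  finally have nn: "(\<Prod>i=1..d. 1 / ennreal (a i powr lam i)) = ennreal (Gamma L / G) *
      (\<integral>\<^sup>+v\<in>C. (1 / ennreal (A v powr L) * ennreal (w v)) \<partial>lebesgue_coords d)" .

  have real: "set_integrable (lebesgue_coords d) C (\<lambda>v. 1 / A v powr L * w v) \<and>
     (\<Prod>i=1..d. 1 / a i powr lam i) =
       Gamma L / G * (LINT v:C|lebesgue_coords d. 1 / A v powr L * w v)"
    if "\<forall>i\<in>{1..d}. r * x i \<noteq> 1"
  proof -
    have a_pos: "a i > 0" if "i \<in> {1..d}" for i
      using a_nonneg[OF that] \<open>\<forall>i\<in>{1..d}. r * x i \<noteq> 1\<close> that by (force simp: a_def)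
    let ?f = "\<lambda>v. indicator C v *\<^sub>R (1 / A v powr L * w v)"
    define P where "P = (\<Prod>i=1..d. 1 / a i powr lam i)"
    have P: "P \<ge> 0"
      unfolding P_def by (intro prod_nonneg) auto
    have GL: "Gamma L > 0"
      using L by (rule Gamma_real_pos)
    have f_nonneg: "?f v \<ge> 0" for v
      by (auto simp: w_def indicator_def intro!: divide_nonneg_nonneg mult_nonneg_nonneg prod_nonneg)
    have f_eq: "?f v = 1 / A v powr L * (\<Prod>i=1..d. gamma_kernel (lam i) 0 (u v i))"
      if "v \<in> space (lebesgue_coords d)" for v
      using wC[OF that] by (simp add: mult.left_commute)
    have "(\<lambda>v. 1 / A v powr L * (\<Prod>i=1..d. gamma_kernel (lam i) 0 (u v i))) \<in>
        borel_measurable (lebesgue_coords d)"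
      unfolding A_def by measurable
    hence f_meas: "?f \<in> borel_measurable (lebesgue_coords d)"
      by (subst measurable_cong[OF f_eq])
    have ennreal_recip: "ennreal (1 / y) = 1 / ennreal y" if "y > 0" for y
      using that by (metis divide_ennreal ennreal_1 zero_le_one)
    have "a i powr lam i > 0" if "i \<in> {1..d}" for i
      using a_pos[OF that] by simp
    hence "ennreal P = (\<Prod>i=1..d. 1 / ennreal (a i powr lam i))"
      unfolding P_def
      by (subst prod_ennreal[symmetric]) (auto intro!: prod.cong ennreal_recip)
    also have "\<dots> = ennreal (Gamma L / G) * (\<integral>\<^sup>+v. ennreal (?f v) \<partial>lebesgue_coords d)"
      unfolding nn
    proof (intro arg_cong2[where f = "(*)"] refl nn_integral_cong)
      fix v assume v: "v \<in> space (lebesgue_coords d)"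
      show "1 / ennreal (A v powr L) * ennreal (w v) * indicator C v = ennreal (?f v)"
      proof (cases "v \<in> C \<and> w v \<noteq> 0")
        \<comment> \<open>Division by zero has different values in \<open>ennreal\<close> and \<open>real\<close>, so \<open>A v > 0\<close> is needed.\<close>
        case True
        have "u v i > 0" if "i \<in> {1..d}" for i
        proof (rule ccontr)
          assume "\<not> u v i > 0"
          hence "(\<Prod>i=1..d. gamma_kernel (lam i) 0 (u v i)) = 0"
            using that by (intro prod_zero bexI[of _ i]) (simp_all add: gamma_kernel_def)
          with wC[OF v] True show False by simp
        qed
        hence "A v > 0"
          unfolding A[symmetric] using a_pos assms(1) by (intro sum_pos) auto
        moreover have "w v \<ge> 0"
          unfolding w_def by (intro prod_nonneg) auto
        ultimately show ?thesis
          using True by (simp add: divide_ennreal[symmetric] divide_ennreal_def ennreal_mult ennreal_mult'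
              inverse_ennreal[symmetric] divide_inverse)
      qed auto
    qed
    finally have eq: "ennreal P = ennreal (Gamma L / G) * (\<integral>\<^sup>+v. ennreal (?f v) \<partial>lebesgue_coords d)" .
    have "(\<integral>\<^sup>+v. ennreal (?f v) \<partial>lebesgue_coords d) = ennreal (G / Gamma L) * ennreal P"
      unfolding eq mult.assoc[symmetric] using G GL by (simp add: ennreal_mult[symmetric])
    also have "\<dots> = ennreal (G / Gamma L * P)"
      using G GL P by (intro ennreal_mult[symmetric]) simp_all
    finally have int: "(\<integral>\<^sup>+v. ennreal (?f v) \<partial>lebesgue_coords d) = ennreal (G / Gamma L * P)" .
    have "integrable (lebesgue_coords d) ?f"
      using f_meas f_nonneg int by (intro integrableI_nn_integral_finite) auto
    moreover have "integral\<^sup>L (lebesgue_coords d) ?f = G / Gamma L * P"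
      using f_meas f_nonneg int G GL P by (subst integral_eq_nn_integral) auto
    ultimately show ?thesis
      using G GL unfolding set_integrable_def set_lebesgue_integral_def P_def by simp
  qed
  show ?thesis
    using nn real
    unfolding simplex_nn_integral_def simplex_integrable_def simplex_integral_def
      L_def G_def a_def A_def w_def u_def C_def
    by blast
qed

end
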